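(* Let $d,t\ge 1$. There is a constant $c\in(0,1)$ depending only on $d$ and $t$ such that the following holds. Let $P=\{p_1,\dots,p_N\}$ be a sequence of $N$ points in $\mathbb{R}^d$ and $E\subset\binom{P}{3}$ a semi-algebraic relation of complexity at most $t$ such that every four points of $P$ induce at most two triples belonging to $E$. Then there is a subset $P'\subset P$ with $\binom{P'}{3}\cap E=\emptyset$ and $|P'|\ge 2^{\log^c N}$.
   Context: $\binom{P}{3}$ denotes the set of triples $(p_{i_1},p_{i_2},p_{i_3})$ with $i_1<i_2<i_3$. A relation $E\subset\binom{P}{3}$ is semi-algebraic of complexity at most $t$ if there are polynomials $f_1,\dots,f_t\in\mathbb{R}[x_1,\dots,x_{3d}]$ of degree at most $t$ and a Boolean function $\Phi$ such that, with $E^*=\{x\in\mathbb{R}^{3d}:\Phi(f_1(x)\ge 0,\dots,f_t(x)\ge 0)=1\}$, we have $(p_{i_1},p_{i_2},p_{i_3})\in E$ iff $(p_{i_1},p_{i_2},p_{i_3})\in E^*$ for all $i_1<i_2<i_3$.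
   Formalization: N = 3 is excluded: if E is the single triple of three points, the four-point condition is vacuous and P' has at most 2 points, while 2^{log^c 3} > 2 for every c > 0. N ≥ 1 is assumed so that log N is defined, and the logarithm is taken to base 2. *)

theory Defs
  imports "HOL-Analysis.Analysis" "HOL-Library.Poly_Mapping"
begin

text \<open>
  Real polynomials in variables indexed by \<open>'v\<close>: finitely supported maps from monomials
  (finitely supported exponent maps) to coefficients.
\<close>

type_synonym 'v real_mpoly = "('v \<Rightarrow>\<^sub>0 nat) \<Rightarrow>\<^sub>0 real"

definition mpoly_eval :: "('v::finite) real_mpoly \<Rightarrow> real ^ 'v \<Rightarrow> real" where
  "mpoly_eval f x =
    (\<Sum>m \<in> Poly_Mapping.keys f. Poly_Mapping.lookup f m * (\<Prod>v\<in>UNIV. (x $ v) ^ Poly_Mapping.lookup m v))"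

text \<open>Total degree; the zero polynomial gets degree 0.\<close>

definition mpoly_degree :: "('v::finite) real_mpoly \<Rightarrow> nat" where
  "mpoly_degree f = Max (insert 0 ((\<lambda>m. \<Sum>v\<in>UNIV. Poly_Mapping.lookup m v) ` Poly_Mapping.keys f))"

text \<open>The Boolean function is applied to the list of the \<open>t\<close> truth values.\<close>

definition semialgebraic_set :: "nat \<Rightarrow> (real ^ ('v::finite)) set \<Rightarrow> bool" where
  "semialgebraic_set t A \<longleftrightarrow>
    (\<exists>(fs :: 'v real_mpoly list) (\<Phi> :: bool list \<Rightarrow> bool).
       length fs = t \<and> (\<forall>f\<in>set fs. mpoly_degree f \<le> t) \<and>
       A = {x. \<Phi> (map (\<lambda>f. mpoly_eval f x \<ge> 0) fs)})"

text \<open>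
  With \<open>d = CARD('d)\<close>, the index type \<open>'d + 'd + 'd\<close> has \<open>3 d\<close> elements, so
  \<open>real ^ ('d + 'd + 'd)\<close> is the space of dimension \<open>3 d\<close>.
\<close>

definition join3 :: "real ^ 'd \<Rightarrow> real ^ 'd \<Rightarrow> real ^ 'd \<Rightarrow> real ^ ('d + 'd + 'd)" where
  "join3 x y z = (\<chi> v. case v of Inl i \<Rightarrow> x $ i | Inr (Inl i) \<Rightarrow> y $ i | Inr (Inr i) \<Rightarrow> z $ i)"

text \<open>
  A sequence of \<open>N\<close> points is a function \<open>p\<close> on the indices \<open>{1..N}\<close>; points and increasing
  triples of points are represented by their indices, so no distinctness of the points is needed.
\<close>

definition triples :: "nat set \<Rightarrow> (nat \<times> nat \<times> nat) set" where
  "triples S = {(i, j, k). i \<in> S \<and> j \<in> S \<and> k \<in> S \<and> i < j \<and> j < k}"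

definition semialgebraic_relation ::
    "nat \<Rightarrow> nat \<Rightarrow> (nat \<Rightarrow> real ^ ('d::finite)) \<Rightarrow> (nat \<times> nat \<times> nat) set \<Rightarrow> bool" where
  "semialgebraic_relation t N p E \<longleftrightarrow>
    E \<subseteq> triples {1..N} \<and>
    (\<exists>Estar. semialgebraic_set t Estar \<and>
       (\<forall>(i, j, k) \<in> triples {1..N}. (i, j, k) \<in> E \<longleftrightarrow> join3 (p i) (p j) (p k) \<in> Estar))"

end

theory Submission imports Defs
begin

text \<open>
  Write \<open>f n\<close> for the size of an independent set that can be guaranteed among \<open>n\<close> points. If \<open>E\<close> has
  density below \<open>\<delta>\<close>, a subset of size about \<open>\<delta>\<close> to the power \<open>-1/3\<close> is independent by averaging.
  Otherwise the link of some point \<open>v\<close> has density at least \<open>\<delta>\<close>, and a dense semi-algebraic graph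
  contains a complete bipartite graph on parts \<open>A\<close>, \<open>B\<close> of size polynomial in \<open>\<delta>\<close> times \<open>n\<close>. As no four
  points induce three triples, \<open>E\<close> has no triple meeting both \<open>A\<close> and \<open>B\<close>, so independent subsets of \<open>A\<close>
  and \<open>B\<close> can be united and \<open>f\<close> doubles. With \<open>\<delta>\<close> about 2 to the power \<open>- sqrt (log N)\<close> the doubling can
  be repeated about \<open>sqrt (log N)\<close> times.

  The bipartite statement rests on a weak cutting lemma for homogeneous halfspaces in \<open>D\<close> dimensions
  (with \<open>v\<close> fixed, a polynomial in the other two points is a bilinear form in vectors of monomials). It
  is proved by induction on \<open>D\<close>: dividing by the last coordinate, the halfspaces become the regions above graphs of
  functions \<open>h\<close> of the remaining coordinates; a cutting for the differences of pairs makes most pairs of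
  these functions comparable on each class, and the class is split along the graph of a middle one.
\<close>

section \<open>Weak cuttings for homogeneous halfspaces\<close>

text \<open>Vectors are functions on \<open>nat\<close> of which only the first \<open>D\<close>
  coordinates are read, so the dimension can change inside an induction.\<close>

definition dot :: "nat \<Rightarrow> (nat \<Rightarrow> real) \<Rightarrow> (nat \<Rightarrow> real) \<Rightarrow> real" where
  "dot D u v = (\<Sum>i<D. u i * v i)"

text \<open>The fibres of \<open>f\<close> are the classes of a partition of space, and
  \<open>y\<close> stands for the halfspace with normal vector \<open>b y\<close>; a halfspace
  crosses a class if it splits it.\<close>

definition crossing ::
    "nat \<Rightarrow> ((nat \<Rightarrow> real) \<Rightarrow> nat) \<Rightarrow> nat \<Rightarrow> (nat \<Rightarrow> nat \<Rightarrow> real) \<Rightarrow> nat set \<Rightarrow> nat set" where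
  "crossing D f i b Y =
    {y \<in> Y. \<exists>u v. f u = i \<and> f v = i \<and> (0 \<le> dot D u (b y)) \<noteq> (0 \<le> dot D v (b y))}"

text \<open>
  Iterating a constant factor \<open>q < 1\<close> drives the crossing fraction down to any \<open>\<epsilon>\<close> with a number of classes
  polynomial in the inverse of \<open>\<epsilon>\<close>, so any constant \<open>q < 1\<close> is as good as a proper cutting lemma.
\<close>

definition cuttable :: "nat \<Rightarrow> nat \<Rightarrow> real \<Rightarrow> bool" where
  "cuttable D K q \<longleftrightarrow> (\<forall>b Y. finite Y \<longrightarrow>
    (\<exists>f. (\<forall>u. f u < K) \<and> (\<forall>i. real (card (crossing D f i b Y)) \<le> q * real (card Y))))"

lemma dot_Suc: "dot (Suc D) u v = dot D u v + u D * v D"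
  by (simp add: dot_def)

lemma finite_crossing [simp]: "finite Y \<Longrightarrow> finite (crossing D f i b Y)"
  by (simp add: crossing_def)

lemma crossing_subset: "crossing D f i b Y \<subseteq> Y"
  by (auto simp: crossing_def)

text \<open>Each class is refined by a cutting for just the halfspaces that cross it, so every round
  multiplies the number of classes by \<open>K\<close> and the crossing fraction by
  \<open>q\<close>.\<close>

lemma cuttable_iterate:
  assumes cut: "cuttable D K q" and q: "0 \<le> q"
  shows "cuttable D (K ^ r) (q ^ r)"
proof (induction r)
  case 0
  show ?case
    unfolding cuttable_def
  proof (intro allI impI)
    fix b :: "nat \<Rightarrow> nat \<Rightarrow> real" and Y :: "nat set"
    assume "finite Y"
    then show "\<exists>f. (\<forall>u. f u < K ^ 0) \<and>
        (\<forall>i. real (card (crossing D f i b Y)) \<le> q ^ 0 * real (card Y))"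
      using card_mono[OF \<open>finite Y\<close> crossing_subset]
      by (intro exI[of _ "\<lambda>_. 0"]) auto
  qed
next
  case (Suc r)
  show ?case
    unfolding cuttable_def
  proof (intro allI impI)
    fix b :: "nat \<Rightarrow> nat \<Rightarrow> real" and Y :: "nat set"
    assume fin: "finite Y"
    obtain f where f: "\<And>u. f u < K ^ r"
      and fc: "\<And>i. real (card (crossing D f i b Y)) \<le> q ^ r * real (card Y)"
      using Suc fin unfolding cuttable_def by blast
    have "\<forall>i. \<exists>g. (\<forall>u. g u < K) \<and>
        (\<forall>k. real (card (crossing D g k b (crossing D f i b Y)))
          \<le> q * real (card (crossing D f i b Y)))"
      using cut fin unfolding cuttable_def by (meson finite_crossing)
    then obtain g where g: "\<And>i u. g i u < K"
      and gc: "\<And>i k. real (card (crossing D (g i) k b (crossing D f i b Y)))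
          \<le> q * real (card (crossing D f i b Y))"
      by metis
    \<comment> \<open>The old class and the class inside it, coded as one number in base
      \<open>K\<close>.\<close>
    define h where "h u = f u * K + g (f u) u" for u
    have h_less: "h u < K ^ Suc r" for u
    proof -
      have "h u < (f u + 1) * K"
        using g[of "f u" u] by (simp add: h_def)
      also have "\<dots> \<le> K ^ r * K"
        using f[of u] by (intro mult_right_mono) auto
      finally show ?thesis by (simp add: mult.commute)
    qed
    have h_div: "h u div K = f u" "h u mod K = g (f u) u" for u
      using g[of "f u" u] by (simp_all add: h_def)
    have "real (card (crossing D h i b Y)) \<le> q ^ Suc r * real (card Y)" for i
    proof -
      have "crossing D h i b Y
          \<subseteq> crossing D (g (i div K)) (i mod K) b (crossing D f (i div K) b Y)"
      proof
        fix y
        assume "y \<in> crossing D h i b Y"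
        then obtain u v where y: "y \<in> Y" and uv: "h u = i" "h v = i"
          "(0 \<le> dot D u (b y)) \<noteq> (0 \<le> dot D v (b y))"
          by (auto simp: crossing_def)
        have "f u = i div K" "f v = i div K"
          using uv h_div by metis+
        moreover from this have "g (i div K) u = i mod K" "g (i div K) v = i mod K"
          using uv h_div by metis+
        ultimately show "y \<in> crossing D (g (i div K)) (i mod K) b (crossing D f (i div K) b Y)"
          using y uv unfolding crossing_def by blast
      qed
      then have "real (card (crossing D h i b Y))
          \<le> real (card (crossing D (g (i div K)) (i mod K) b (crossing D f (i div K) b Y)))"
        using fin by (intro of_nat_mono card_mono) auto
      also have "\<dots> \<le> q * real (card (crossing D f (i div K) b Y))"
        by (rule gc)
      also have "\<dots> \<le> q * (q ^ r * real (card Y))"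
        using fc q by (intro mult_left_mono)
      finally show ?thesis by simp
    qed
    with h_less show "\<exists>f. (\<forall>u. f u < K ^ Suc r) \<and>
        (\<forall>i. real (card (crossing D f i b Y)) \<le> q ^ Suc r * real (card Y))"
      by blast
  qed
qed

text \<open>Take a member with the largest value of \<open>g\<close>: all other members lie weakly
  below it, and fewer than \<open>s\<close> elements do.\<close>

lemma card_low_rank:
  fixes g :: "'a \<Rightarrow> 'b::linorder" and s :: real
  assumes fin: "finite Y" and s: "0 \<le> s"
  shows "real (card {y \<in> Y. real (card {z \<in> Y. g z \<le> g y}) < s}) \<le> s"
proof (cases "{y \<in> Y. real (card {z \<in> Y. g z \<le> g y}) < s} = {}")
  case True
  then show ?thesis using s by (simp only: card.empty of_nat_0)
next
  case False
  define L where "L = {y \<in> Y. real (card {z \<in> Y. g z \<le> g y}) < s}"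
  have L: "finite L" "L \<noteq> {}"
    using False fin by (auto simp: L_def)
  then have "Max (g ` L) \<in> g ` L" by simp
  then obtain y where y: "y \<in> L" "g y = Max (g ` L)" by auto
  have "L \<subseteq> {z \<in> Y. g z \<le> g y}"
    using L y by (auto simp: L_def)
  then have "real (card L) \<le> real (card {z \<in> Y. g z \<le> g y})"
    using fin by (intro of_nat_mono card_mono) auto
  also have "\<dots> < s"
    using y by (simp add: L_def)
  finally show ?thesis by (simp add: L_def)
qed

text \<open>
  \<open>B\<close> collects the pairs whose order by \<open>g\<close> is not reliable, because it changes within the class at hand.
\<close>

lemma exists_central_element:
  fixes g :: "'a \<Rightarrow> real"
  assumes fin: "finite Y" and ne: "Y \<noteq> {}" and B: "B \<subseteq> Y \<times> Y"
    and card_B: "36 * real (card B) \<le> real (card Y) * real (card Y)"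
  shows "\<exists>c\<in>Y. real (card Y) \<le> 6 * real (card {y \<in> Y. g y \<le> g c \<and> (y, c) \<notin> B}) \<and>
    real (card Y) \<le> 6 * real (card {y \<in> Y. g c \<le> g y \<and> (c, y) \<notin> B})"
proof -
  define m where "m = real (card Y)"
  have m: "m > 0" using fin ne by (auto simp: m_def card_gt_0_iff)
  have finB: "finite B" using B fin finite_subset by blast
  define lo where "lo y = {z \<in> Y. g z \<le> g y}" for y
  define hi where "hi y = {z \<in> Y. g y \<le> g z}" for y
  define L where "L = {y \<in> Y. real (card (lo y)) < m / 3}"
  define H where "H = {y \<in> Y. real (card (hi y)) < m / 3}"
  have fins: "finite L" "finite H" "finite (lo y)" "finite (hi y)" for y
    using fin by (auto simp: L_def H_def lo_def hi_def)
  have L: "real (card L) \<le> m / 3"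
    using card_low_rank[OF fin, of "m / 3" g] m by (simp add: L_def lo_def)
  have H: "real (card H) \<le> m / 3"
    using card_low_rank[OF fin, of "m / 3" "\<lambda>y. - g y"] m by (simp add: H_def hi_def)
  \<comment> \<open>The middle part in the order by \<open>g\<close>: each member has at least
    \<open>m / 3\<close> elements of \<open>Y\<close> weakly on either side.\<close>
  define M where "M = Y - (L \<union> H)"
  have M: "m / 3 \<le> real (card M)"
  proof -
    have "card Y \<le> card (M \<union> L \<union> H)"
      using fin fins by (intro card_mono) (auto simp: M_def)
    also have "\<dots> \<le> card M + card L + card H"
      using card_Un_le[of "M \<union> L" H] card_Un_le[of M L] by linarith
    finally show ?thesis using L H by (simp add: m_def)
  qed
  define ind where "ind y = {z \<in> Y. (z, y) \<in> B}" for y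
  define outd where "outd y = {z \<in> Y. (y, z) \<in> B}" for y
  have fins': "finite (ind y)" "finite (outd y)" for y
    using fin by (auto simp: ind_def outd_def)
  have sum_out: "(\<Sum>y\<in>Y. card (outd y)) = card B"
  proof -
    have "B = (SIGMA y:Y. outd y)" using B by (auto simp: outd_def)
    then show ?thesis using fin fins' by (metis card_SigmaI)
  qed
  have sum_in: "(\<Sum>y\<in>Y. card (ind y)) = card B"
  proof -
    have "prod.swap ` B = (SIGMA y:Y. ind y)" using B by (force simp: ind_def)
    then have "card (prod.swap ` B) = (\<Sum>y\<in>Y. card (ind y))"
      using fin fins' by (metis card_SigmaI)
    then show ?thesis by (simp add: card_image)
  qed
  \<comment> \<open>In- and out-degrees sum to \<open>2 * card B\<close>, which is at most
    \<open>m / 3 * (m / 6)\<close>; this is the origin of the 36. A \<open>c\<close> of total degree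
    at most \<open>m / 6\<close> keeps at least \<open>m / 3 - m / 6\<close> reliable comparisons on
    either side.\<close>
  have "\<exists>c\<in>M. real (card (ind c)) + real (card (outd c)) \<le> m / 6"
  proof (rule ccontr)
    assume "\<not> ?thesis"
    then have gt: "\<And>c. c \<in> M \<Longrightarrow> m / 6 < real (card (ind c)) + real (card (outd c))"
      by force
    have Mne: "finite M" "M \<noteq> {}"
      using fin M m unfolding atomize_conj by (intro conjI notI) (simp add: M_def, simp)
    have "m / 3 * (m / 6) \<le> real (card M) * (m / 6)"
      using M m by (intro mult_right_mono) auto
    also have "\<dots> = (\<Sum>c\<in>M. m / 6)" by simp
    also have "\<dots> < (\<Sum>c\<in>M. real (card (ind c)) + real (card (outd c)))"
      using Mne gt by (intro sum_strict_mono) auto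
    also have "\<dots> \<le> (\<Sum>c\<in>Y. real (card (ind c)) + real (card (outd c)))"
      using fin by (intro sum_mono2) (auto simp: M_def)
    also have "\<dots> = 2 * real (card B)"
      using sum_in sum_out by (simp add: sum.distrib flip: of_nat_sum)
    finally show False using card_B by (simp add: m_def)
  qed
  then obtain c where c: "c \<in> M"
    and deg: "real (card (ind c)) + real (card (outd c)) \<le> m / 6" by blast
  have cY: "c \<in> Y" and lohi: "m / 3 \<le> real (card (lo c))" "m / 3 \<le> real (card (hi c))"
    using c by (auto simp: M_def L_def H_def)
  have "card (lo c) \<le> card ({y \<in> Y. g y \<le> g c \<and> (y, c) \<notin> B} \<union> ind c)"
    using fin by (intro card_mono) (auto simp: lo_def ind_def)
  also have "\<dots> \<le> card {y \<in> Y. g y \<le> g c \<and> (y, c) \<notin> B} + card (ind c)"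
    by (rule card_Un_le)
  finally have 1: "m / 6 \<le> real (card {y \<in> Y. g y \<le> g c \<and> (y, c) \<notin> B})"
    using lohi deg by linarith
  have "card (hi c) \<le> card ({y \<in> Y. g c \<le> g y \<and> (c, y) \<notin> B} \<union> outd c)"
    using fin by (intro card_mono) (auto simp: hi_def outd_def)
  also have "\<dots> \<le> card {y \<in> Y. g c \<le> g y \<and> (c, y) \<notin> B} + card (outd c)"
    by (rule card_Un_le)
  finally have 2: "m / 6 \<le> real (card {y \<in> Y. g c \<le> g y \<and> (c, y) \<notin> B})"
    using lohi deg by linarith
  from cY 1 2 show ?thesis unfolding m_def by force
qed

text \<open>Such a halfspace is the region above the graph of a function \<open>h y\<close> of the
  first \<open>D\<close> coordinates. Within a class, points above the graph of a central
  \<open>h c\<close> lie in every halfspace whose graph stays below that of \<open>c\<close>, and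
  points strictly below it lie outside every halfspace whose graph stays above. Either way a sixth
  of the halfspaces does not cross, while the number of classes doubles.\<close>

lemma cut_positive_last:
  assumes cut: "cuttable D K q" and q: "q \<le> 1 / 36" and fin: "finite Y"
    and pos: "\<And>y. y \<in> Y \<Longrightarrow> 0 < b y D"
  shows "\<exists>f. (\<forall>u. f u < 2 * K) \<and>
    (\<forall>i. real (card (crossing (Suc D) f i b Y)) \<le> 5 / 6 * real (card Y))"
proof -
  define h where "h y u = - dot D u (b y) / b y D" for y u
  have R: "0 \<le> dot (Suc D) u (b y) \<longleftrightarrow> h y u \<le> u D" if "y \<in> Y" for u y
    using pos_divide_le_eq[OF pos[OF that], of "- dot D u (b y)" "u D"] unfolding dot_Suc h_def by linarith
  \<comment> \<open>The product of \<open>u\<close> with this vector is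
    \<open>h y' u - h y u\<close>, so a \<open>D\<close>-dimensional cutting controls comparisons of
    pairs. Pairs are coded by \<open>prod_encode\<close> because \<open>cuttable\<close> speaks of
    sets of natural numbers.\<close>
  define \<beta> where "\<beta> z = (case prod_decode z of (y, y') \<Rightarrow> \<lambda>i. b y i / b y D - b y' i / b y' D)" for z
  have \<beta>: "0 \<le> dot D u (\<beta> (prod_encode (y, y'))) \<longleftrightarrow> h y u \<le> h y' u" for u y y'
    by (simp add: \<beta>_def dot_def h_def sum_divide_distrib sum_subtractf right_diff_distrib)
  define Z where "Z = prod_encode ` (Y \<times> Y)"
  have finZ: "finite Z" and cardZ: "card Z = card Y * card Y"
    using fin by (simp_all add: Z_def card_image inj_prod_encode card_cartesian_product)
  obtain f where f: "\<And>u. f u < K"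
    and fc: "\<And>i. real (card (crossing D f i \<beta> Z)) \<le> q * real (card Z)"
    using cut finZ unfolding cuttable_def by metis
  define B where "B i = {(y, y'). prod_encode (y, y') \<in> crossing D f i \<beta> Z}" for i
  have B_sub: "B i \<subseteq> Y \<times> Y" for i
    using crossing_subset[of D f i \<beta> Z] by (auto simp: B_def Z_def dest: inj_onD[OF inj_prod_encode])
  have cons: "h y v \<le> h y' v"
    if "y \<in> Y" "y' \<in> Y" "(y, y') \<notin> B i" "h y u \<le> h y' u" "f u = i" "f v = i" for y y' u v i
    using that \<beta> unfolding B_def crossing_def Z_def by blast
  have card_B: "36 * real (card (B i)) \<le> real (card Y) * real (card Y)" for i
  proof -
    have "card (B i) = card (prod_encode ` B i)"
      by (simp add: card_image inj_prod_encode)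
    also have "\<dots> \<le> card (crossing D f i \<beta> Z)"
      using finZ by (intro card_mono) (auto simp: B_def)
    finally have "real (card (B i)) \<le> q * real (card Z)"
      using fc[of i] by linarith
    also have "\<dots> \<le> 1 / 36 * real (card Z)"
      using q by (intro mult_right_mono) auto
    finally show ?thesis by (simp add: cardZ)
  qed
  \<comment> \<open>Only those \<open>y\<close> are counted that compare with \<open>c\<close> in
    the same way on the whole class, so the centre depends on the class and not on a point of
    it.\<close>
  have "\<exists>c. Y \<noteq> {} \<longrightarrow> c \<in> Y \<and> (\<forall>u. f u = i \<longrightarrow>
      real (card Y) \<le> 6 * real (card {y \<in> Y. \<forall>v. f v = i \<longrightarrow> h y v \<le> h c v}) \<and>
      real (card Y) \<le> 6 * real (card {y \<in> Y. \<forall>v. f v = i \<longrightarrow> h c v \<le> h y v}))" for i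
  proof (cases "Y \<noteq> {} \<and> (\<exists>u. f u = i)")
    case True
    then obtain u where u: "f u = i" by blast
    obtain c where c: "c \<in> Y"
      "real (card Y) \<le> 6 * real (card {y \<in> Y. h y u \<le> h c u \<and> (y, c) \<notin> B i})"
      "real (card Y) \<le> 6 * real (card {y \<in> Y. h c u \<le> h y u \<and> (c, y) \<notin> B i})"
      using exists_central_element[OF fin _ B_sub[of i] card_B[of i], where g = "\<lambda>y. h y u"] True by blast
    have "card {y \<in> Y. h y u \<le> h c u \<and> (y, c) \<notin> B i} \<le> card {y \<in> Y. \<forall>v. f v = i \<longrightarrow> h y v \<le> h c v}"
      using fin c(1) u cons by (intro card_mono) auto
    moreover have "card {y \<in> Y. h c u \<le> h y u \<and> (c, y) \<notin> B i} \<le> card {y \<in> Y. \<forall>v. f v = i \<longrightarrow> h c v \<le> h y v}"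
      using fin c(1) u cons by (intro card_mono) auto
    ultimately show ?thesis
      using c by (intro exI[of _ c]) auto
  qed auto
  then obtain c where "\<And>i. Y \<noteq> {} \<longrightarrow> c i \<in> Y \<and> (\<forall>u. f u = i \<longrightarrow>
      real (card Y) \<le> 6 * real (card {y \<in> Y. \<forall>v. f v = i \<longrightarrow> h y v \<le> h (c i) v}) \<and>
      real (card Y) \<le> 6 * real (card {y \<in> Y. \<forall>v. f v = i \<longrightarrow> h (c i) v \<le> h y v}))"
    by (rule that[OF someI_ex])
  then have c:
    "real (card Y) \<le> 6 * real (card {y \<in> Y. \<forall>v. f v = f u \<longrightarrow> h y v \<le> h (c (f u)) v})"
    "real (card Y) \<le> 6 * real (card {y \<in> Y. \<forall>v. f v = f u \<longrightarrow> h (c (f u)) v \<le> h y v})"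
    if "Y \<noteq> {}" for u
    using that by blast+
  \<comment> \<open>The parity of \<open>F u\<close> records on which side of the graph of the
    centre \<open>u\<close> lies.\<close>
  define F where "F u = 2 * f u + (if h (c (f u)) u \<le> u D then 1 else 0)" for u
  have F_less: "F u < 2 * K" for u
    using f[of u] by (simp add: F_def)
  have "real (card (crossing (Suc D) F i b Y)) \<le> 5 / 6 * real (card Y)" for i
  proof (cases "crossing (Suc D) F i b Y = {}")
    case True
    then show ?thesis by simp
  next
    case False
    then obtain w y0 where w: "F w = i" and y0: "y0 \<in> Y"
      by (auto simp: crossing_def)
    have fi: "f u = f w" "(h (c (f w)) u \<le> u D) = (h (c (f w)) w \<le> w D)" if "F u = i" for u
    proof -
      have "F u = F w" using that w by simp
      then show "f u = f w"
        by (simp add: F_def split: if_splits)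
      with \<open>F u = F w\<close> show "(h (c (f w)) u \<le> u D) = (h (c (f w)) w \<le> w D)"
        by (simp add: F_def split: if_splits)
    qed
    have "\<exists>G. G \<subseteq> Y \<and> real (card Y) \<le> 6 * real (card G) \<and> G \<inter> crossing (Suc D) F i b Y = {}"
    proof (cases "h (c (f w)) w \<le> w D")
      case True
      define G where "G = {y \<in> Y. \<forall>v. f v = f w \<longrightarrow> h y v \<le> h (c (f w)) v}"
      have "0 \<le> dot (Suc D) u (b y)" if "y \<in> G" "F u = i" for y u
        using that fi[of u] True R[of y u] unfolding G_def by force
      then have "G \<inter> crossing (Suc D) F i b Y = {}"
        by (auto simp: crossing_def)
      then show ?thesis
        using c(1)[of w] y0 by (intro exI[of _ G]) (auto simp: G_def)
    next
      case False
      define G where "G = {y \<in> Y. \<forall>v. f v = f w \<longrightarrow> h (c (f w)) v \<le> h y v}"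
      have "\<not> 0 \<le> dot (Suc D) u (b y)" if "y \<in> G" "F u = i" for y u
        using that fi[of u] False R[of y u] unfolding G_def by force
      then have "G \<inter> crossing (Suc D) F i b Y = {}"
        by (auto simp: crossing_def)
      then show ?thesis
        using c(2)[of w] y0 by (intro exI[of _ G]) (auto simp: G_def)
    qed
    then obtain G where G: "G \<subseteq> Y" "real (card Y) \<le> 6 * real (card G)"
      "G \<inter> crossing (Suc D) F i b Y = {}" by blast
    have "card G + card (crossing (Suc D) F i b Y) = card (G \<union> crossing (Suc D) F i b Y)"
      using G fin finite_subset[OF G(1) fin] by (intro card_Un_disjoint[symmetric]) auto
    also have "\<dots> \<le> card Y"
      using G fin crossing_subset by (intro card_mono) auto
    finally show ?thesis using G(2) by simp
  qed
  with F_less show ?thesis by blast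
qed

text \<open>One of the three signs of the last normal coordinate occurs for at least a third of
  \<open>Y\<close>. Only these halfspaces are cut; all others may cross, and a fraction
  \<open>(1 - p) / 3\<close> still does not.\<close>

lemma cuttable_Suc:
  assumes cut: "cuttable D K q" and q: "0 < q" "q < 1"
  shows "\<exists>K' q'. 0 < q' \<and> q' < 1 \<and> cuttable (Suc D) K' q'"
proof -
  \<comment> \<open>Enough iterations to reach the fraction 1/36 that
    \<open>cut_positive_last\<close> asks for.\<close>
  obtain r where r: "q ^ r < 1 / 36"
    using real_arch_pow_inv[of "1 / 36" q] q by auto
  have cut': "cuttable D (K ^ r) (q ^ r)"
    using cuttable_iterate[OF cut] q by simp
  \<comment> \<open>\<open>K'\<close> and \<open>p\<close> cover all three signs:
    \<open>2 * K ^ r\<close> classes and 5/6 for a nonzero last coordinate, \<open>K\<close> classes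
    and \<open>q\<close> for a zero one.\<close>
  define K' where "K' = 2 * K ^ r + K"
  define p where "p = max q (5 / 6)"
  have p: "0 < p" "p < 1" "q \<le> p" "5 / 6 \<le> p" using q by (auto simp: p_def)
  define q' where "q' = 1 - (1 - p) / 3"
  have q': "0 < q'" "q' < 1" using p by (auto simp: q'_def field_simps)
  have "\<exists>f. (\<forall>u. f u < K') \<and>
      (\<forall>i. real (card (crossing (Suc D) f i b Y)) \<le> q' * real (card Y))"
    if fin: "finite Y" for b :: "nat \<Rightarrow> nat \<Rightarrow> real" and Y
  proof -
    define Yp where "Yp = {y \<in> Y. 0 < b y D}"
    define Yn where "Yn = {y \<in> Y. b y D < 0}"
    define Yz where "Yz = {y \<in> Y. b y D = 0}"
    have fins: "finite Yp" "finite Yn" "finite Yz"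
      using fin by (auto simp: Yp_def Yn_def Yz_def)
    have extend: ?thesis
      if f: "\<And>u. f u < K'" and S: "S \<subseteq> Y" "real (card Y) \<le> 3 * real (card S)"
        and fc: "\<And>i. real (card (crossing (Suc D) f i b S)) \<le> p * real (card S)" for f S
    proof -
      have "real (card (crossing (Suc D) f i b Y)) \<le> q' * real (card Y)" for i
      proof -
        have "card (crossing (Suc D) f i b Y) \<le> card (crossing (Suc D) f i b S \<union> (Y - S))"
          using fin S finite_subset[OF S(1) fin] by (intro card_mono) (auto simp: crossing_def)
        also have "\<dots> \<le> card (crossing (Suc D) f i b S) + card (Y - S)"
          by (rule card_Un_le)
        also have "card (Y - S) = card Y - card S"
          using S fin by (simp add: card_Diff_subset finite_subset)
        finally have "real (card (crossing (Suc D) f i b Y))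
            \<le> real (card (crossing (Suc D) f i b S)) + (real (card Y) - real (card S))"
          using card_mono[OF fin S(1)] by linarith
        also have "\<dots> \<le> real (card Y) - (1 - p) * real (card S)"
          using fc[of i] by (simp add: algebra_simps)
        also have "\<dots> \<le> real (card Y) - (1 - p) * (real (card Y) / 3)"
          using S p by (intro diff_left_mono mult_left_mono) auto
        finally show ?thesis by (simp add: q'_def algebra_simps)
      qed
      with f show ?thesis by blast
    qed
    have weaken: "real n \<le> p * real m" if "real n \<le> s * real m" "s \<le> p" for n m s
      using that by (meson mult_right_mono of_nat_0_le_iff order_trans)
    have "card Y \<le> card (Yp \<union> Yn \<union> Yz)"
      using fins by (intro card_mono) (auto simp: Yp_def Yn_def Yz_def)
    also have "\<dots> \<le> card Yp + card Yn + card Yz"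
      using card_Un_le[of "Yp \<union> Yn" Yz] card_Un_le[of Yp Yn] by linarith
    finally consider "real (card Y) \<le> 3 * real (card Yp)" | "real (card Y) \<le> 3 * real (card Yn)"
      | "real (card Y) \<le> 3 * real (card Yz)"
      by linarith
    then show ?thesis
    proof cases
      case 1
      obtain f where f: "\<And>u. f u < 2 * K ^ r"
        and fc: "\<And>i. real (card (crossing (Suc D) f i b Yp)) \<le> 5 / 6 * real (card Yp)"
        using cut_positive_last[OF cut' less_imp_le[OF r] fins(1), of b] unfolding Yp_def by blast
      show ?thesis
      proof (rule extend)
        show "f u < K'" for u using f[of u] by (simp add: K'_def)
        show "Yp \<subseteq> Y" by (auto simp: Yp_def)
        show "real (card (crossing (Suc D) f i b Yp)) \<le> p * real (card Yp)" for i
          using fc p(4) by (rule weaken)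
      qed fact
    next
      case 2
      \<comment> \<open>Negating the last coordinate of both arguments preserves the product and
        makes the normal coordinate positive; the labelling is then pulled back along
        \<open>flip\<close>.\<close>
      define flip where "flip u = u(D := - u D)" for u :: "nat \<Rightarrow> real"
      have flip: "dot (Suc D) (flip u) (flip v) = dot (Suc D) u v" for u v
        by (simp add: dot_Suc flip_def) (simp add: dot_def)
      have pos: "\<And>y. y \<in> Yn \<Longrightarrow> 0 < flip (b y) D" by (simp add: Yn_def flip_def)
      obtain f where f: "\<And>u. f u < 2 * K ^ r"
        and fc: "\<And>i. real (card (crossing (Suc D) f i (\<lambda>y. flip (b y)) Yn)) \<le> 5 / 6 * real (card Yn)"
        using cut_positive_last[OF cut' less_imp_le[OF r] fins(2), of "\<lambda>y. flip (b y)"] pos by blast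
      have sub: "crossing (Suc D) (\<lambda>u. f (flip u)) i b Yn
          \<subseteq> crossing (Suc D) f i (\<lambda>y. flip (b y)) Yn" for i
      proof
        fix y
        assume "y \<in> crossing (Suc D) (\<lambda>u. f (flip u)) i b Yn"
        then obtain u v where "y \<in> Yn" "f (flip u) = i" "f (flip v) = i"
          "(0 \<le> dot (Suc D) u (b y)) \<noteq> (0 \<le> dot (Suc D) v (b y))"
          unfolding crossing_def by blast
        then have "y \<in> Yn \<and> f (flip u) = i \<and> f (flip v) = i \<and>
            (0 \<le> dot (Suc D) (flip u) (flip (b y))) \<noteq> (0 \<le> dot (Suc D) (flip v) (flip (b y)))"
          by (simp only: flip simp_thms)
        then show "y \<in> crossing (Suc D) f i (\<lambda>y. flip (b y)) Yn"
          unfolding crossing_def by blast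
      qed
      have fc': "real (card (crossing (Suc D) (\<lambda>u. f (flip u)) i b Yn)) \<le> 5 / 6 * real (card Yn)" for i
        using card_mono[OF finite_crossing[OF fins(2)] sub[of i]] fc[of i] by linarith
      show ?thesis
      proof (rule extend)
        show "f (flip u) < K'" for u using f[of "flip u"] by (simp add: K'_def)
        show "Yn \<subseteq> Y" by (auto simp: Yn_def)
        show "real (card (crossing (Suc D) (\<lambda>u. f (flip u)) i b Yn)) \<le> p * real (card Yn)" for i
          using fc' p(4) by (rule weaken)
      qed fact
    next
      case 3
      obtain f where f: "\<And>u. f u < K"
        and fc: "\<And>i. real (card (crossing D f i b Yz)) \<le> q * real (card Yz)"
        using cut fins(3) unfolding cuttable_def by metis
      have "crossing (Suc D) f i b Yz = crossing D f i b Yz" for i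
      proof -
        have "dot (Suc D) u (b y) = dot D u (b y)" if "y \<in> Yz" for u y
          using that by (simp add: dot_Suc Yz_def)
        then show ?thesis
          unfolding crossing_def by (intro Collect_cong conj_cong refl) simp
      qed
      then have fc': "real (card (crossing (Suc D) f i b Yz)) \<le> q * real (card Yz)" for i
        using fc by simp
      show ?thesis
      proof (rule extend)
        show "f u < K'" for u using f[of u] by (simp add: K'_def)
        show "Yz \<subseteq> Y" by (auto simp: Yz_def)
        show "real (card (crossing (Suc D) f i b Yz)) \<le> p * real (card Yz)" for i
          using fc' p(3) by (rule weaken)
      qed fact
    qed
  qed
  then show ?thesis
    using q' unfolding cuttable_def by blast
qed

lemma exists_cuttable: "\<exists>K q. 0 < q \<and> q < 1 \<and> cuttable D K q"
proof (induction D)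
  case 0
  \<comment> \<open>In dimension 0 every product is the empty sum, so no halfspace crosses.\<close>
  have "cuttable 0 1 (1 / 2)"
    unfolding cuttable_def by (intro allI impI exI[of _ "\<lambda>_. 0"]) (simp add: crossing_def dot_def)
  then show ?case
    by (intro exI[of _ "1::nat"] exI[of _ "1 / 2 :: real"]) simp
next
  case (Suc D)
  then obtain K q where "0 < q" "q < 1" "cuttable D K q" by blast
  then show ?case by (intro cuttable_Suc)
qed

section \<open>Complete bipartite subgraphs of dense graphs defined by signs of bilinear
  forms\<close>

text \<open>\<open>X\<close> is partitioned by the common refinement of \<open>T\<close> cuttings,
  one per form. A \<open>y\<close> outside \<open>Bad c\<close> has constant signs on the class
  \<open>A c\<close>, so it is adjacent to all of it or to none; hence edges from \<open>A c\<close>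
  end in \<open>B c\<close> or \<open>Bad c\<close>. If no class met both size bounds, there would
  be too few edges.\<close>

lemma dense_bipartite:
  fixes \<alpha> \<beta> :: "nat \<Rightarrow> nat \<Rightarrow> nat \<Rightarrow> real" and n \<delta> q :: real
  assumes cut: "cuttable D K q" and Tq: "real T * q \<le> \<delta> / 4" and \<delta>: "0 < \<delta>"
    and fin: "finite X" "finite Y" and n: "real (card X) \<le> n" "real (card Y) \<le> n" "0 < n"
    and G: "\<And>x x' y. \<lbrakk>x \<in> X; x' \<in> X; y \<in> Y; G x y;
        \<forall>l<T. (0 \<le> dot D (\<alpha> l x) (\<beta> l y)) = (0 \<le> dot D (\<alpha> l x') (\<beta> l y))\<rbrakk> \<Longrightarrow> G x' y"
    and dense: "\<delta> * n * n \<le> real (card {(x, y). x \<in> X \<and> y \<in> Y \<and> G x y})"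
  shows "\<exists>A B. A \<subseteq> X \<and> B \<subseteq> Y \<and> (\<forall>x\<in>A. \<forall>y\<in>B. G x y) \<and>
    \<delta> * n \<le> 8 * real (K ^ T) * real (card A) \<and> \<delta> * n \<le> 2 * real (card B)"
proof -
  have "\<forall>l. \<exists>f. (\<forall>u. f u < K) \<and> (\<forall>i. real (card (crossing D f i (\<beta> l) Y)) \<le> q * real (card Y))"
    using cut fin unfolding cuttable_def by blast
  then obtain f where f: "\<And>l u. f l u < K"
    and fc: "\<And>l i. real (card (crossing D (f l) i (\<beta> l) Y)) \<le> q * real (card Y)"
    by metis
  \<comment> \<open>The tuple of the \<open>T\<close> classes of \<open>x\<close>;
    \<open>restrict\<close> fixes the values from \<open>T\<close> on, so that only
    \<open>K ^ T\<close> labels are possible.\<close>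
  define lab where "lab x = restrict (\<lambda>l. f l (\<alpha> l x)) {..<T}" for x
  define C where "C = ({..<T} \<rightarrow>\<^sub>E {..<K})"
  have finC: "finite C" and cardC: "card C = K ^ T"
    by (simp_all add: C_def finite_PiE card_PiE)
  have lab: "lab x \<in> C" for x using f by (auto simp: lab_def C_def)
  define M where "M = real (K ^ T)"
  have "card C > 0" using lab finC by (auto simp: card_gt_0_iff)
  then have M: "0 < M" "real (card C) = M" by (auto simp: M_def cardC)
  define A where "A c = {x \<in> X. lab x = c}" for c
  define B where "B c = {y \<in> Y. \<forall>x\<in>A c. G x y}" for c
  define Bad where "Bad c = (\<Union>l<T. crossing D (f l) (c l) (\<beta> l) Y)" for c
  have fins: "finite (A c)" "finite (B c)" "finite (Bad c)" for c
    using fin by (auto simp: A_def B_def Bad_def)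
  have Bad: "real (card (Bad c)) \<le> \<delta> / 4 * n" for c
  proof -
    have "real (card (Bad c)) \<le> (\<Sum>l<T. real (card (crossing D (f l) (c l) (\<beta> l) Y)))"
      unfolding Bad_def using card_UN_le[of "{..<T}"] by (simp flip: of_nat_sum)
    also have "\<dots> \<le> (\<Sum>l<T. q * real (card Y))" by (intro sum_mono fc)
    also have "\<dots> = real T * q * real (card Y)" by simp
    also have "\<dots> \<le> \<delta> / 4 * n" using Tq n \<delta> by (intro mult_mono) auto
    finally show ?thesis .
  qed
  have "\<exists>c\<in>C. \<delta> * n \<le> 8 * M * real (card (A c)) \<and> \<delta> * n \<le> 2 * real (card (B c))"
  proof (rule ccontr)
    assume contra: "\<not> ?thesis"
    define E where "E c = {(x, y). x \<in> A c \<and> y \<in> Y \<and> G x y}" for c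
    have E_sub: "E c \<subseteq> A c \<times> (B c \<union> Bad c)" for c
    proof (rule subrelI, rule ccontr)
      fix x y
      assume xy: "(x, y) \<in> E c" and "(x, y) \<notin> A c \<times> (B c \<union> Bad c)"
      then have nb: "y \<notin> Bad c" and nB: "y \<notin> B c"
        by (auto simp: E_def)
      have "G x' y" if x': "x' \<in> A c" for x'
      proof (rule G)
        show "\<forall>l<T. (0 \<le> dot D (\<alpha> l x) (\<beta> l y)) = (0 \<le> dot D (\<alpha> l x') (\<beta> l y))"
        proof (intro allI impI)
          fix l assume l: "l < T"
          have "lab x l = c l" "lab x' l = c l"
            using xy x' by (auto simp: E_def A_def)
          then have "f l (\<alpha> l x) = c l" "f l (\<alpha> l x') = c l"
            using l by (auto simp: lab_def)
          then show "(0 \<le> dot D (\<alpha> l x) (\<beta> l y)) = (0 \<le> dot D (\<alpha> l x') (\<beta> l y))"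
            using nb l xy unfolding Bad_def crossing_def E_def by blast
        qed
      qed (use xy x' in \<open>auto simp: E_def A_def\<close>)
      then show False
        using xy nB by (auto simp: E_def B_def)
    qed
    have finE: "finite (E c)" for c
      using E_sub fins by (meson finite_SigmaI finite_UnI finite_subset)
    \<comment> \<open>A small class carries at most \<open>\<delta> * n * n / (8 * M)\<close> edges,
      which sums to an eighth of \<open>\<delta> * n * n\<close>. For a large class, a half from
      \<open>B c\<close> and a quarter from \<open>Bad c\<close> give the 3/4. The total of 7/8
      falls short of the density.\<close>
    have E_le: "real (card (E c)) \<le> \<delta> * n * n / (8 * M) + 3 / 4 * \<delta> * n * real (card (A c))"
      if c: "c \<in> C" for c
    proof (cases "\<delta> * n \<le> 8 * M * real (card (A c))")
      case True
      then have B: "2 * real (card (B c)) < \<delta> * n" using contra c by force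
      have "card (E c) \<le> card (A c \<times> (B c \<union> Bad c))"
        using E_sub fins by (intro card_mono) auto
      also have "\<dots> \<le> card (A c) * (card (B c) + card (Bad c))"
        by (simp add: card_cartesian_product card_Un_le)
      finally have "real (card (E c)) \<le> real (card (A c)) * (real (card (B c)) + real (card (Bad c)))"
        by (metis of_nat_add of_nat_le_iff of_nat_mult)
      also have "\<dots> \<le> real (card (A c)) * (3 / 4 * \<delta> * n)"
        using B Bad[of c] by (intro mult_left_mono) auto
      moreover have "0 \<le> \<delta> * n * n / (8 * M)" using \<delta> n M by simp
      ultimately show ?thesis by (simp add: algebra_simps)
    next
      case False
      have "card (E c) \<le> card (A c \<times> Y)"
        using fins fin by (intro card_mono) (auto simp: E_def)
      then have "real (card (E c)) \<le> real (card (A c)) * real (card Y)"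
        by (metis card_cartesian_product of_nat_le_iff of_nat_mult)
      also have "\<dots> \<le> \<delta> * n / (8 * M) * n"
        using False n M \<delta> by (intro mult_mono) (auto simp: field_simps)
      moreover have "0 \<le> 3 / 4 * \<delta> * n * real (card (A c))" using \<delta> n by simp
      ultimately show ?thesis by (simp add: algebra_simps)
    qed
    have card_sum: "(\<Sum>c\<in>C. card (A c)) = card X"
    proof -
      have "X = (\<Union>c\<in>C. A c)" using lab by (auto simp: A_def)
      moreover have "card (\<Union>c\<in>C. A c) = (\<Sum>c\<in>C. card (A c))"
        using finC fins by (intro card_UN_disjoint) (auto simp: A_def)
      ultimately show ?thesis by simp
    qed
    have "{(x, y). x \<in> X \<and> y \<in> Y \<and> G x y} = (\<Union>c\<in>C. E c)"
      using lab by (auto simp: E_def A_def)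
    then have "real (card {(x, y). x \<in> X \<and> y \<in> Y \<and> G x y}) \<le> (\<Sum>c\<in>C. real (card (E c)))"
      using card_UN_le[OF finC, of E] by (simp flip: of_nat_sum)
    also have "\<dots> \<le> (\<Sum>c\<in>C. \<delta> * n * n / (8 * M) + 3 / 4 * \<delta> * n * real (card (A c)))"
      by (intro sum_mono E_le)
    also have "\<dots> = M * (\<delta> * n * n / (8 * M)) + 3 / 4 * \<delta> * n * real (card X)"
      unfolding sum.distrib sum_distrib_left[symmetric] card_sum[symmetric] using M by simp
    also have "\<dots> \<le> \<delta> * n * n / 8 + 3 / 4 * \<delta> * n * n"
      using M n \<delta> by (intro add_mono mult_left_mono) auto
    also have "\<dots> = 7 / 8 * (\<delta> * n * n)" by simp
    also have "\<dots> < \<delta> * n * n" using \<delta> n by simp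
    finally show False using dense by simp
  qed
  then obtain c where "\<delta> * n \<le> 8 * M * real (card (A c))" "\<delta> * n \<le> 2 * real (card (B c))"
    by blast
  moreover have "A c \<subseteq> X" "B c \<subseteq> Y" "\<forall>x\<in>A c. \<forall>y\<in>B c. G x y"
    by (auto simp: A_def B_def)
  ultimately show ?thesis unfolding M_def by blast
qed

section \<open>Independent sets in sparse triple systems\<close>

lemma card_supersets:
  assumes fin: "finite W" and e: "e \<subseteq> W" "card e \<le> k"
  shows "card {S. e \<subseteq> S \<and> S \<subseteq> W \<and> card S = k} = (card W - card e) choose (k - card e)"
proof -
  have fe: "finite e" using fin e finite_subset by blast
  have "bij_betw (\<lambda>S. S \<union> e) {S. S \<subseteq> W - e \<and> card S = k - card e}
      {S. e \<subseteq> S \<and> S \<subseteq> W \<and> card S = k}"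
  proof (rule bij_betw_byWitness[where f' = "\<lambda>S. S - e"])
    show "(\<lambda>S. S \<union> e) ` {S. S \<subseteq> W - e \<and> card S = k - card e}
        \<subseteq> {S. e \<subseteq> S \<and> S \<subseteq> W \<and> card S = k}"
    proof clarify
      fix S assume S: "S \<subseteq> W - e" "card S = k - card e"
      then have "card (S \<union> e) = card S + card e"
        using fe fin finite_subset[of S W] by (intro card_Un_disjoint) auto
      then show "e \<subseteq> S \<union> e \<and> S \<union> e \<subseteq> W \<and> card (S \<union> e) = k" using S e by auto
    qed
    show "(\<lambda>S. S - e) ` {S. e \<subseteq> S \<and> S \<subseteq> W \<and> card S = k}
        \<subseteq> {S. S \<subseteq> W - e \<and> card S = k - card e}"
      using fe by (auto simp: card_Diff_subset)
  qed auto
  then have "card {S. e \<subseteq> S \<and> S \<subseteq> W \<and> card S = k} = card {S. S \<subseteq> W - e \<and> card S = k - card e}"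
    by (simp add: bij_betw_same_card)
  also have "\<dots> = card (W - e) choose (k - card e)"
    using fin by (intro n_subsets) auto
  also have "card (W - e) = card W - card e"
    using fe e by (simp add: card_Diff_subset)
  finally show ?thesis .
qed

lemma triples_mono: "A \<subseteq> B \<Longrightarrow> triples A \<subseteq> triples B"
  by (auto simp: triples_def)

lemma finite_triples: "finite W \<Longrightarrow> finite (triples W)"
  by (rule finite_subset[of _ "W \<times> W \<times> W"]) (auto simp: triples_def)

text \<open>A union bound: if every \<open>k\<close>-subset contained a triple of \<open>E\<close>,
  then \<open>n choose k\<close> would be at most the number of triples times
  \<open>(n - 3) choose (k - 3)\<close>, so \<open>n * (n - 1) * (n - 2)\<close> would be at most
  \<open>k ^ 3\<close> times that number. For \<open>n\<close> at least 6 this product is at least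
  \<open>n ^ 3 / 2\<close>.\<close>

lemma sparse_independent:
  assumes fin: "finite W" and k: "3 \<le> k" "k \<le> card W" and W: "6 \<le> card W"
    and sparse: "2 * real (card (triples W \<inter> E)) * real k ^ 3 < real (card W) ^ 3"
  shows "\<exists>S\<subseteq>W. card S = k \<and> triples S \<inter> E = {}"
proof (rule ccontr)
  assume contra: "\<not> ?thesis"
  define n where "n = card W"
  define F where "F = triples W \<inter> E"
  have finF: "finite F" using fin finite_triples by (simp add: F_def)
  have "{S. S \<subseteq> W \<and> card S = k} \<subseteq> (\<Union>(x, y, z)\<in>F. {S. {x, y, z} \<subseteq> S \<and> S \<subseteq> W \<and> card S = k})"
  proof clarify
    fix S assume S: "S \<subseteq> W" "k = card S"
    then have "triples S \<inter> E \<noteq> {}" using contra by auto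
    then obtain x y z where "(x, y, z) \<in> triples S" "(x, y, z) \<in> E" by auto
    then show "S \<in> (\<Union>(x, y, z)\<in>F. {S'. {x, y, z} \<subseteq> S' \<and> S' \<subseteq> W \<and> card S' = card S})"
      using S triples_mono[OF S(1)] by (intro UN_I[of "(x, y, z)"]) (auto simp: F_def triples_def)
  qed
  then have "card {S. S \<subseteq> W \<and> card S = k}
      \<le> card (\<Union>(x, y, z)\<in>F. {S. {x, y, z} \<subseteq> S \<and> S \<subseteq> W \<and> card S = k})"
    by (rule card_mono[rotated]) (use fin finF in auto)
  also have "\<dots> \<le> (\<Sum>(x, y, z)\<in>F. card {S. {x, y, z} \<subseteq> S \<and> S \<subseteq> W \<and> card S = k})"
    using card_UN_le[OF finF] by (simp add: case_prod_unfold)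
  also have "\<dots> = (\<Sum>e\<in>F. (n - 3) choose (k - 3))"
  proof (intro sum.cong refl, clarify)
    fix x y z assume "(x, y, z) \<in> F"
    then have "{x, y, z} \<subseteq> W" "card {x, y, z} = 3" by (auto simp: F_def triples_def)
    then show "card {S. {x, y, z} \<subseteq> S \<and> S \<subseteq> W \<and> card S = k} = (n - 3) choose (k - 3)"
      using card_supersets[OF fin, of "{x, y, z}" k] k by (simp add: n_def)
  qed
  finally have 1: "(n choose k) \<le> card F * ((n - 3) choose (k - 3))"
    using fin by (simp add: n_subsets n_def)
  obtain m j where m: "n = m + 3" and j: "k = j + 3"
    using k by (metis add.commute le_Suc_ex n_def order_trans)
  have jm: "j \<le> m" using k m j by (simp add: n_def)
  \<comment> \<open>The absorption identity for binomial coefficients, applied three times;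
    \<open>m\<close> and \<open>j\<close> avoid truncated subtraction.\<close>
  have "k * (k - 1) * (k - 2) * (n choose k) = n * (n - 1) * (n - 2) * (m choose j)"
  proof -
    define B1 B2 B3 where "B1 = ((m + 1) choose (j + 1))" and "B2 = ((m + 2) choose (j + 2))"
      and "B3 = ((m + 3) choose (j + 3))"
    have e: "(j + 1) * B1 = (m + 1) * (m choose j)" "(j + 2) * B2 = (m + 2) * B1"
      "(j + 3) * B3 = (m + 3) * B2"
      using Suc_times_binomial_eq[of m j] Suc_times_binomial_eq[of "m + 1" "j + 1"]
        Suc_times_binomial_eq[of "m + 2" "j + 2"]
      by (simp_all add: B1_def B2_def B3_def eval_nat_numeral mult.commute del: binomial_Suc_Suc)
    have "(j + 3) * (j + 2) * (j + 1) * B3 = (j + 2) * (j + 1) * ((j + 3) * B3)"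
      by (simp only: mult_ac)
    also have "\<dots> = (m + 3) * (j + 1) * ((j + 2) * B2)"
      unfolding e(3) by (simp only: mult_ac)
    also have "\<dots> = (m + 3) * (m + 2) * ((j + 1) * B1)"
      unfolding e(2) by (simp only: mult_ac)
    also have "\<dots> = (m + 3) * (m + 2) * (m + 1) * (m choose j)"
      unfolding e(1) by (simp only: mult_ac)
    finally have "(j + 3) * (j + 2) * (j + 1) * B3 = (m + 3) * (m + 2) * (m + 1) * (m choose j)" .
    then show ?thesis by (simp add: m j B3_def del: binomial_Suc_Suc)
  qed
  then have "n * (n - 1) * (n - 2) * (m choose j) = k * (k - 1) * (k - 2) * (n choose k)" ..
  also have "\<dots> \<le> k * (k - 1) * (k - 2) * (card F * (m choose j))"
    using 1 by (intro mult_left_mono) (simp_all add: m j)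
  finally have "(n * (n - 1) * (n - 2)) * (m choose j) \<le> (k * (k - 1) * (k - 2) * card F) * (m choose j)"
    by (simp add: mult_ac)
  then have "n * (n - 1) * (n - 2) \<le> k * (k - 1) * (k - 2) * card F"
    using jm by simp
  also have "\<dots> \<le> k * k * k * card F"
    by (intro mult_mono) auto
  finally have 2: "real (n * (n - 1) * (n - 2)) \<le> real k ^ 3 * real (card F)"
    by (metis of_nat_le_iff of_nat_mult power3_eq_cube)
  have "real n ^ 3 \<le> 2 * (real n * (real n - 1) * (real n - 2))"
  proof -
    define s where "s = real n - 6"
    have s: "real n = s + 6" "0 \<le> s" using W by (simp_all add: s_def n_def)
    have "2 * ((s + 6) * (s + 6 - 1) * (s + 6 - 2)) - (s + 6) ^ 3 = s ^ 3 + 12 * s ^ 2 + 40 * s + 24"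
      by (simp add: algebra_simps power3_eq_cube power2_eq_square)
    moreover have "0 \<le> s ^ 3 + 12 * s ^ 2 + 40 * s + 24" using s by simp
    ultimately show ?thesis unfolding s(1) by linarith
  qed
  also have "\<dots> = 2 * real (n * (n - 1) * (n - 2))"
    using W by (simp add: n_def of_nat_diff)
  finally show False using 2 sparse by (simp add: n_def F_def mult_ac)
qed

section \<open>Polynomials as bilinear forms and the link of a point\<close>

text \<open>No exponent exceeds the total degree, so the monomials inject into the maps from
  variables to \<open>{..t}\<close>.\<close>

lemma card_keys_le:
  fixes f :: "('v::finite) real_mpoly"
  assumes "mpoly_degree f \<le> t"
  shows "card (Poly_Mapping.keys f) \<le> (t + 1) ^ CARD('v)"
proof -
  have "Poly_Mapping.lookup m v \<le> t" if "m \<in> Poly_Mapping.keys f" for m v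
  proof -
    have "Poly_Mapping.lookup m v \<le> (\<Sum>v\<in>UNIV. Poly_Mapping.lookup m v)"
      by (intro member_le_sum) auto
    also have "\<dots> \<le> mpoly_degree f"
      unfolding mpoly_degree_def using that by (intro Max_ge) auto
    finally show ?thesis using assms by simp
  qed
  then have "Poly_Mapping.lookup ` Poly_Mapping.keys f \<subseteq> UNIV \<rightarrow>\<^sub>E {..t}"
    by auto
  then have "card (Poly_Mapping.lookup ` Poly_Mapping.keys f) \<le> card ((UNIV :: 'v set) \<rightarrow>\<^sub>E {..t})"
    by (intro card_mono finite_PiE) auto
  moreover have "inj_on Poly_Mapping.lookup (Poly_Mapping.keys f)"
    by (rule inj_onI) (simp only: Poly_Mapping.lookup_inject)
  ultimately show ?thesis
    by (simp add: card_image card_PiE)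
qed

text \<open>With \<open>x\<close> fixed, each monomial is one coordinate: \<open>a\<close> carries
  its part in \<open>y\<close>, and \<open>b\<close> its coefficient and its parts in
  \<open>x\<close> and \<open>z\<close>. Padding \<open>a\<close> with zeros up to \<open>D\<close>
  lets polynomials with different numbers of monomials share a dimension.\<close>

lemma mpoly_eval_join3_bilinear:
  fixes f :: "('d::finite + 'd + 'd) real_mpoly"
  assumes "card (Poly_Mapping.keys f) \<le> D"
  shows "\<exists>a b. \<forall>y z. mpoly_eval f (join3 x y z) = dot D (a y) (b z)"
proof -
  define n where "n = card (Poly_Mapping.keys f)"
  obtain h where h: "bij_betw h {0..<n} (Poly_Mapping.keys f)"
    using ex_bij_betw_nat_finite[of "Poly_Mapping.keys f"] by (auto simp: n_def)
  define e where "e m v = Poly_Mapping.lookup (h m) v" for m v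
  define a where "a y m = (if m < n then \<Prod>i\<in>UNIV. (y $ i) ^ e m (Inr (Inl i)) else 0)"
    for y :: "real ^ 'd" and m
  define b where "b z m = Poly_Mapping.lookup f (h m) *
      ((\<Prod>i\<in>UNIV. (x $ i) ^ e m (Inl i)) * (\<Prod>i\<in>UNIV. (z $ i) ^ e m (Inr (Inr i))))"
    for z :: "real ^ 'd" and m
  have prod: "(\<Prod>v\<in>UNIV. (join3 x y z $ v) ^ e m v) =
      (\<Prod>i\<in>UNIV. (x $ i) ^ e m (Inl i)) * ((\<Prod>i\<in>UNIV. (y $ i) ^ e m (Inr (Inl i))) *
      (\<Prod>i\<in>UNIV. (z $ i) ^ e m (Inr (Inr i))))" for y z m
    by (simp add: join3_def prod.Plus flip: UNIV_Plus_UNIV)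
  have "mpoly_eval f (join3 x y z) = dot D (a y) (b z)" for y z
  proof -
    have "mpoly_eval f (join3 x y z) =
        (\<Sum>m\<in>{0..<n}. Poly_Mapping.lookup f (h m) * (\<Prod>v\<in>UNIV. (join3 x y z $ v) ^ e m v))"
      unfolding mpoly_eval_def e_def by (rule sum.reindex_bij_betw[OF h, symmetric])
    also have "\<dots> = (\<Sum>m\<in>{0..<n}. a y m * b z m)"
      by (intro sum.cong refl) (simp add: prod a_def b_def mult_ac)
    also have "\<dots> = dot D (a y) (b z)"
      unfolding dot_def using assms by (intro sum.mono_neutral_left) (auto simp: a_def n_def)
    finally show ?thesis .
  qed
  then show ?thesis by blast
qed

text \<open>By averaging, some \<open>v\<close> in \<open>W\<close> is the least point of at least
  \<open>card W ^ 2 / 2 ^ L\<close> triples, and \<open>dense_bipartite\<close> applies to its link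
  with density \<open>(1 / 2) ^ L\<close>. As \<open>c\<close> is chosen before \<open>L\<close>,
  the loss is polynomial in the density.\<close>

lemma semialgebraic_dense_link:
  "\<exists>c\<ge>1. \<forall>N (p :: nat \<Rightarrow> real ^ 'd::finite) E L W.
    semialgebraic_relation t N p E \<longrightarrow> 1 \<le> L \<longrightarrow> W \<subseteq> {1..N} \<longrightarrow> W \<noteq> {} \<longrightarrow>
    card W ^ 3 \<le> 2 ^ L * card (triples W \<inter> E) \<longrightarrow>
    (\<exists>v\<in>W. \<exists>A\<subseteq>W. \<exists>B\<subseteq>W. (\<forall>a\<in>A. \<forall>b\<in>B. v < a \<and> a < b \<and> (v, a, b) \<in> E) \<and>
      card W \<le> 2 ^ (c * L) * card A \<and> card W \<le> 2 ^ (c * L) * card B)"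
proof -
  define D0 where "D0 = (t + 1) ^ CARD('d + 'd + 'd)"
  \<comment> \<open>Two further coordinates make room for the form that encodes the order of the
    indices.\<close>
  define D where "D = Suc (Suc D0)"
  obtain K q where q: "0 < q" "q < 1" and cut: "cuttable D K q"
    using exists_cuttable by blast
  define T where "T = t + 1"
  \<comment> \<open>With \<open>c1 * L\<close> iterations of the cutting, \<open>T\<close> times the
    crossing fraction is at most \<open>(1 / 8) ^ L\<close>, hence at most a quarter of the
    density.\<close>
  obtain c1 where c1: "q ^ c1 < 1 / (8 * real T)"
    using real_arch_pow_inv[of "1 / (8 * real T)" q] q by (auto simp: T_def)
  \<comment> \<open>The 4 pays for the inverse density \<open>2 ^ L\<close> and for
    \<open>8 \<le> 2 ^ (3 * L)\<close>, the product for the number of classes, by way of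
    \<open>K \<le> 2 ^ K\<close>.\<close>
  define c where "c = 4 + K * c1 * T"
  have "\<exists>v\<in>W. \<exists>A\<subseteq>W. \<exists>B\<subseteq>W. (\<forall>a\<in>A. \<forall>b\<in>B. v < a \<and> a < b \<and> (v, a, b) \<in> E) \<and>
      card W \<le> 2 ^ (c * L) * card A \<and> card W \<le> 2 ^ (c * L) * card B"
    if rel: "semialgebraic_relation t N p E" and L: "1 \<le> L" and W: "W \<subseteq> {1..N}" "W \<noteq> {}"
      and dense: "card W ^ 3 \<le> 2 ^ L * card (triples W \<inter> E)"
    for N and p :: "nat \<Rightarrow> real ^ 'd" and E L W
  proof -
    have fin: "finite W" using W finite_subset by blast
    define n where "n = card W"
    have n: "0 < n" using fin W by (simp add: n_def card_gt_0_iff)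
    define link where "link v = {(x, y). x \<in> {j \<in> W. v < j} \<and> y \<in> {j \<in> W. v < j} \<and> (x < y \<and> (v, x, y) \<in> E)}"
      for v
    have fin_link: "finite (link v)" for v
      by (rule finite_subset[of _ "W \<times> W"]) (auto simp: link_def fin)
    have sum_link: "card (triples W \<inter> E) = (\<Sum>v\<in>W. card (link v))"
    proof -
      have "triples W \<inter> E = (SIGMA v:W. link v)"
        by (auto simp: triples_def link_def)
      then show ?thesis using fin fin_link by (metis card_SigmaI)
    qed
    obtain v where v: "v \<in> W" and link: "n * n \<le> 2 ^ L * card (link v)"
    proof -
      have "\<exists>v\<in>W. n * n \<le> 2 ^ L * card (link v)"
      proof (rule ccontr)
        assume "\<not> ?thesis"
        then have "(\<Sum>v\<in>W. 2 ^ L * card (link v)) < (\<Sum>v\<in>W. n * n)"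
          using fin W by (intro sum_strict_mono) auto
        then show False
          using dense by (simp add: sum_link n_def power3_eq_cube sum_distrib_left)
      qed
      then show ?thesis using that by blast
    qed
    define X where "X = {j \<in> W. v < j}"
    obtain Estar where Estar_rel: "\<forall>(i, j, k) \<in> triples {1..N}.
        (i, j, k) \<in> E \<longleftrightarrow> join3 (p i) (p j) (p k) \<in> Estar" and "semialgebraic_set t Estar"
      using rel unfolding semialgebraic_relation_def by (elim conjE exE)
    have E: "(i, j, k) \<in> E \<longleftrightarrow> join3 (p i) (p j) (p k) \<in> Estar"
      if "(i, j, k) \<in> triples {1..N}" for i j k
      using bspec[OF Estar_rel that] by simp
    from \<open>semialgebraic_set t Estar\<close> obtain fs :: "('d + 'd + 'd) real_mpoly list" and \<Phi> where fs: "length fs = t"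
      "\<And>f. f \<in> set fs \<Longrightarrow> mpoly_degree f \<le> t"
      and Estar: "Estar = {x. \<Phi> (map (\<lambda>f. mpoly_eval f x \<ge> 0) fs)}"
      unfolding semialgebraic_set_def by blast
    have "\<exists>ab. \<forall>y z. mpoly_eval (fs ! l) (join3 (p v) y z) = dot D (fst ab y) (snd ab z)" if "l < t" for l
    proof -
      have "card (Poly_Mapping.keys (fs ! l)) \<le> D"
        using card_keys_le[OF fs(2), of "fs ! l"] that fs(1) by (simp add: D_def D0_def)
      then show ?thesis
        using mpoly_eval_join3_bilinear[of "fs ! l" D "p v"] by (metis fst_conv snd_conv)
    qed
    then obtain ab where ab: "\<And>l y z. l < t \<Longrightarrow>
        mpoly_eval (fs ! l) (join3 (p v) y z) = dot D (fst (ab l) y) (snd (ab l) z)"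
      by metis
    \<comment> \<open>The form with index \<open>t\<close> evaluates to \<open>k - j - 1\<close> and so encodes \<open>j < k\<close>.\<close>
    define \<alpha> where "\<alpha> l j = (if l < t then fst (ab l) (p j) else
        (\<lambda>m. if m = 0 then - real j - 1 else if m = 1 then 1 else 0))" for l j
    define \<beta> where "\<beta> l k = (if l < t then snd (ab l) (p k) else
        (\<lambda>m. if m = 0 then 1 else if m = 1 then real k else 0))" for l k
    have ord: "0 \<le> dot D (\<alpha> t j) (\<beta> t k) \<longleftrightarrow> j < k" for j k
    proof -
      have "dot D (\<alpha> t j) (\<beta> t k) = (\<Sum>m\<in>{0, 1}. \<alpha> t j m * \<beta> t k m)"
        unfolding dot_def by (intro sum.mono_neutral_right) (auto simp: \<alpha>_def \<beta>_def D_def)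
      also have "\<dots> = real k - real j - 1"
        by (simp add: \<alpha>_def \<beta>_def)
      finally have "dot D (\<alpha> t j) (\<beta> t k) = real k - real j - 1" .
      then show ?thesis by auto
    qed
    define r where "r = c1 * L"
    define \<delta> :: real where "\<delta> = (1 / 2) ^ L"
    have Tq: "real T * q ^ r \<le> \<delta> / 4"
    proof -
      have "q ^ r \<le> (1 / (8 * real T)) ^ L"
        unfolding r_def power_mult using q c1 by (intro power_mono) auto
      also have "\<dots> = (1 / 8) ^ L * (1 / real T) ^ L"
        by (simp add: power_divide power_mult_distrib)
      also have "\<dots> \<le> (1 / 8) ^ L * (1 / real T)"
        using L power_decreasing[of 1 L "1 / real T"] by (intro mult_left_mono) (auto simp: T_def)
      finally have "real T * q ^ r \<le> real T * ((1 / 8) ^ L * (1 / real T))"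
        by (rule mult_left_mono) simp
      also have "\<dots> = (1 / 8) ^ L" by (simp add: T_def)
      also have "(1 / 8 :: real) ^ L = \<delta> * (1 / 4) ^ L"
        by (simp add: \<delta>_def flip: power_mult_distrib)
      also have "\<dots> \<le> \<delta> * (1 / 4)"
        using L power_decreasing[of 1 L "1 / 4 :: real"] by (intro mult_left_mono) (auto simp: \<delta>_def)
      finally show ?thesis by simp
    qed
    have "real (n * n) \<le> real (2 ^ L * card (link v))"
      using link by (simp only: of_nat_le_iff)
    then have dense': "\<delta> * real n * real n \<le> real (card (link v))"
      by (simp add: \<delta>_def field_simps)
    have X: "finite X" "card X \<le> n"
      using fin by (auto simp: X_def n_def intro!: card_mono)
    have "\<exists>A B. A \<subseteq> X \<and> B \<subseteq> X \<and> (\<forall>x\<in>A. \<forall>y\<in>B. x < y \<and> (v, x, y) \<in> E) \<and>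
        \<delta> * real n \<le> 8 * real ((K ^ r) ^ T) * real (card A) \<and> \<delta> * real n \<le> 2 * real (card B)"
    proof (rule dense_bipartite[OF cuttable_iterate[OF cut] Tq])
      fix x x' y
      assume xy: "x \<in> X" "x' \<in> X" "y \<in> X" "x < y \<and> (v, x, y) \<in> E"
        and eq: "\<forall>l<T. (0 \<le> dot D (\<alpha> l x) (\<beta> l y)) = (0 \<le> dot D (\<alpha> l x') (\<beta> l y))"
      \<comment> \<open>The sign with index \<open>t\<close> carries the order over to
        \<open>x'\<close>, so that both triples are increasing and \<open>Estar\<close> decides
        their membership in \<open>E\<close>.\<close>
      from eq have "x' < y" using xy ord by (auto simp: T_def)
      then have tr: "(v, x, y) \<in> triples {1..N}" "(v, x', y) \<in> triples {1..N}"
        using xy v W by (auto simp: triples_def X_def)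
      have signs: "map (\<lambda>f. 0 \<le> mpoly_eval f (join3 (p v) (p x) (p y))) fs =
          map (\<lambda>f. 0 \<le> mpoly_eval f (join3 (p v) (p x') (p y))) fs"
      proof (rule nth_equalityI)
        fix l assume "l < length (map (\<lambda>f. 0 \<le> mpoly_eval f (join3 (p v) (p x) (p y))) fs)"
        then have "l < t" using fs by simp
        then show "map (\<lambda>f. 0 \<le> mpoly_eval f (join3 (p v) (p x) (p y))) fs ! l =
            map (\<lambda>f. 0 \<le> mpoly_eval f (join3 (p v) (p x') (p y))) fs ! l"
          using eq[rule_format, of l] fs ab by (simp add: \<alpha>_def \<beta>_def T_def)
      qed simp
      have "join3 (p v) (p x) (p y) \<in> Estar \<longleftrightarrow> join3 (p v) (p x') (p y) \<in> Estar"
        unfolding Estar mem_Collect_eq signs ..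
      then show "x' < y \<and> (v, x', y) \<in> E"
        using E[OF tr(1)] E[OF tr(2)] xy \<open>x' < y\<close> by simp
    next
      show "\<delta> * real n * real n \<le> real (card {(x, y). x \<in> X \<and> y \<in> X \<and> x < y \<and> (v, x, y) \<in> E})"
        using dense' unfolding link_def X_def .
    qed (use q X n in \<open>auto simp: \<delta>_def\<close>)
    then obtain A B where AB: "A \<subseteq> X" "B \<subseteq> X" "\<forall>x\<in>A. \<forall>y\<in>B. x < y \<and> (v, x, y) \<in> E"
      and cA: "\<delta> * real n \<le> 8 * real ((K ^ r) ^ T) * real (card A)"
      and cB: "\<delta> * real n \<le> 2 * real (card B)"
      by blast
    have "n \<le> 2 ^ L * (8 * (K ^ r) ^ T * card A)"
    proof -
      have "real n \<le> 2 ^ L * (8 * real ((K ^ r) ^ T) * real (card A))"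
        using cA by (simp add: \<delta>_def field_simps)
      also have "\<dots> = real (2 ^ L * (8 * (K ^ r) ^ T * card A))" by simp
      finally show ?thesis by (simp only: of_nat_le_iff)
    qed
    also have "(K ^ r) ^ T \<le> ((2 ^ K) ^ r) ^ T"
      by (intro power_mono) (auto intro: less_imp_le less_exp)
    also have "((2 ^ K) ^ r) ^ T = (2::nat) ^ (K * c1 * T * L)"
      by (simp add: r_def mult_ac flip: power_mult)
    also have "(8::nat) \<le> 2 ^ (3 * L)"
      using power_increasing[of 3 "3 * L" "2::nat"] L by simp
    also have "2 ^ L * (2 ^ (3 * L) * 2 ^ (K * c1 * T * L) * card A) = 2 ^ (c * L) * card A"
      by (simp add: c_def algebra_simps flip: power_add)
    finally have nA: "n \<le> 2 ^ (c * L) * card A" by simp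
    have "n \<le> 2 ^ L * (2 * card B)"
    proof -
      have "real n \<le> 2 ^ L * (2 * real (card B))"
        using cB by (simp add: \<delta>_def field_simps)
      also have "\<dots> = real (2 ^ L * (2 * card B))" by simp
      finally show ?thesis by (simp only: of_nat_le_iff)
    qed
    also have "\<dots> = 2 ^ (L + 1) * card B" by simp
    also have "\<dots> \<le> 2 ^ (c * L) * card B"
    proof (intro mult_right_mono power_increasing)
      have "L + 1 \<le> 2 * L" using L by simp
      also have "\<dots> \<le> c * L" by (intro mult_right_mono) (auto simp: c_def)
      finally show "L + 1 \<le> c * L" .
    qed auto
    finally have nB: "n \<le> 2 ^ (c * L) * card B" .
    show ?thesis
      using v AB nA nB unfolding n_def X_def
      by (intro bexI[of _ v] exI[of _ A] exI[of _ B] conjI) auto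
  qed
  moreover have "1 \<le> c" by (simp add: c_def)
  ultimately show ?thesis by blast
qed

section \<open>Doubling independent sets\<close>

lemma card_ge_3:
  assumes "finite F" "{a, b, c} \<subseteq> F" "distinct [a, b, c]"
  shows "3 \<le> card F"
  using card_mono[OF assms(1,2)] assms(3) by simp

text \<open>All of \<open>A\<close> precedes all of \<open>B\<close>, so a triple of
  \<open>E\<close> meeting both has two points in \<open>A\<close> followed by one in
  \<open>B\<close>, or one followed by two. With two triples through \<open>v\<close> it would make
  three triples on four points.\<close>

lemma independent_Un:
  fixes A B :: "nat set"
  assumes four: "\<forall>S\<subseteq>{1..N}. card S = 4 \<longrightarrow> card (triples S \<inter> E) \<le> 2"
    and sub: "v \<in> {1..N}" "A \<subseteq> {1..N}" "B \<subseteq> {1..N}"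
    and link: "\<forall>a\<in>A. \<forall>b\<in>B. v < a \<and> a < b \<and> (v, a, b) \<in> E"
    and ind: "triples A \<inter> E = {}" "triples B \<inter> E = {}"
  shows "triples (A \<union> B) \<inter> E = {}"
proof -
  have no3: False
    if "{x, y, z} \<subseteq> {1..N}" "v < x" "x < y" "y < z"
      and "{t1, t2, t3} \<subseteq> triples {v, x, y, z} \<inter> E" "distinct [t1, t2, t3]" for x y z t1 t2 t3
  proof -
    have "card {v, x, y, z} = 4" using that by auto
    moreover have "{v, x, y, z} \<subseteq> {1..N}" using that sub by auto
    ultimately have "card (triples {v, x, y, z} \<inter> E) \<le> 2" using four by blast
    moreover have "finite (triples {v, x, y, z} \<inter> E)" by (simp add: finite_triples)
    ultimately show False using card_ge_3[OF _ that(5,6)] by linarith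
  qed
  have "(x, y, z) \<notin> E" if "(x, y, z) \<in> triples (A \<union> B)" for x y z
  proof
    assume e: "(x, y, z) \<in> E"
    have xyz: "x \<in> A \<union> B" "y \<in> A \<union> B" "z \<in> A \<union> B" "x < y" "y < z"
      using that by (auto simp: triples_def)
    have le: "a < b" if "a \<in> A" "b \<in> B" for a b using link that by blast
    have "\<not> (x \<in> B \<and> y \<in> A)" "\<not> (x \<in> B \<and> z \<in> A)" "\<not> (y \<in> B \<and> z \<in> A)"
      using le[of y x] le[of z x] le[of z y] xyz by auto
    with xyz consider "x \<in> A" "y \<in> A" "z \<in> A" | "x \<in> B" "y \<in> B" "z \<in> B"
      | "x \<in> A" "y \<in> A" "z \<in> B" | "x \<in> A" "y \<in> B" "z \<in> B"
      by blast
    then show False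
    proof cases
      case 1 then show ?thesis using e xyz ind(1) by (auto simp: triples_def)
    next
      case 2 then show ?thesis using e xyz ind(2) by (auto simp: triples_def)
    next
      case 3
      then show ?thesis
        using e xyz link sub
        by (intro no3[of x y z "(v, x, z)" "(v, y, z)" "(x, y, z)"]) (auto simp: triples_def)
    next
      case 4
      then show ?thesis
        using e xyz link sub
        by (intro no3[of x y z "(v, x, y)" "(v, x, z)" "(x, y, z)"]) (auto simp: triples_def)
    qed
  qed
  then show ?thesis by auto
qed

text \<open>Induction on the number \<open>i\<close> of doublings. A dense \<open>W\<close> is
  replaced by \<open>A\<close> and \<open>B\<close>, at the cost of a factor
  \<open>2 ^ (c * L)\<close> in size, and their independent sets are united. A sparse
  \<open>W\<close> yields at once an independent set of size \<open>2 ^ j\<close>, enough for every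
  \<open>i \<le> j\<close>; the threshold density \<open>(1 / 2) ^ L\<close> is the inverse cube of
  that size up to a constant.\<close>

lemma independent_doubling:
  fixes N c j :: nat
  defines "L \<equiv> 3 * j + 2"
  assumes c: "1 \<le> c" and j: "2 \<le> j"
    and four: "\<forall>S\<subseteq>{1..N}. card S = 4 \<longrightarrow> card (triples S \<inter> E) \<le> 2"
    and link: "\<And>W. \<lbrakk>W \<subseteq> {1..N}; W \<noteq> {}; card W ^ 3 \<le> 2 ^ L * card (triples W \<inter> E)\<rbrakk> \<Longrightarrow>
      \<exists>v\<in>W. \<exists>A\<subseteq>W. \<exists>B\<subseteq>W. (\<forall>a\<in>A. \<forall>b\<in>B. v < a \<and> a < b \<and> (v, a, b) \<in> E) \<and>
        card W \<le> 2 ^ (c * L) * card A \<and> card W \<le> 2 ^ (c * L) * card B"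
  shows "\<lbrakk>i \<le> j; W \<subseteq> {1..N}; 2 ^ (c * L * (i + 1)) \<le> card W\<rbrakk> \<Longrightarrow>
    \<exists>S\<subseteq>W. triples S \<inter> E = {} \<and> 2 ^ i \<le> card S"
proof (induction i arbitrary: W)
  case 0
  have "0 < card W" by (rule less_le_trans[OF _ 0(3)]) simp
  then obtain a where "a \<in> W" by fastforce
  then show ?case by (intro exI[of _ "{a}"]) (auto simp: triples_def)
next
  case (Suc i)
  have fin: "finite W" using Suc.prems finite_subset by blast
  have pos: "0 < card W" by (rule less_le_trans[OF _ Suc.prems(3)]) simp
  show ?case
  proof (cases "card W ^ 3 \<le> 2 ^ L * card (triples W \<inter> E)")
    case True
    have "W \<noteq> {}" using pos by auto
    from link[OF Suc.prems(2) this True] obtain v A B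
      where v: "v \<in> W" and AB: "A \<subseteq> W" "B \<subseteq> W"
        and full: "\<forall>a\<in>A. \<forall>b\<in>B. v < a \<and> a < b \<and> (v, a, b) \<in> E"
        and card: "card W \<le> 2 ^ (c * L) * card A" "card W \<le> 2 ^ (c * L) * card B"
      by blast
    have big: "2 ^ (c * L * (i + 1)) \<le> card C" if "card W \<le> 2 ^ (c * L) * card C" for C :: "nat set"
    proof -
      have "(2::nat) ^ (c * L) * 2 ^ (c * L * (i + 1)) = 2 ^ (c * L * (Suc i + 1))"
        by (simp add: algebra_simps flip: power_add)
      also have "\<dots> \<le> 2 ^ (c * L) * card C" using Suc.prems(3) that by linarith
      finally show ?thesis by simp
    qed
    obtain SA where SA: "SA \<subseteq> A" "triples SA \<inter> E = {}" "2 ^ i \<le> card SA"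
      using Suc.IH[of A] big[OF card(1)] AB Suc.prems by auto
    obtain SB where SB: "SB \<subseteq> B" "triples SB \<inter> E = {}" "2 ^ i \<le> card SB"
      using Suc.IH[of B] big[OF card(2)] AB Suc.prems by auto
    have "\<forall>a\<in>SA. \<forall>b\<in>SB. v < a \<and> a < b \<and> (v, a, b) \<in> E"
      using full SA(1) SB(1) by blast
    moreover have "v \<in> {1..N}" "SA \<subseteq> {1..N}" "SB \<subseteq> {1..N}"
      using v AB SA(1) SB(1) Suc.prems(2) by blast+
    ultimately have "triples (SA \<union> SB) \<inter> E = {}"
      using SA(2) SB(2) by (intro independent_Un[OF four, of v])
    moreover have "SA \<inter> SB = {}" using full SA SB by fastforce
    then have "card (SA \<union> SB) = card SA + card SB"
      using fin SA SB AB by (meson card_Un_disjoint finite_subset)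
    ultimately show ?thesis
      using SA SB AB by (intro exI[of _ "SA \<union> SB"]) auto
  next
    case False
    have "1 * L * 1 \<le> c * L * (Suc i + 1)"
      using c by (intro mult_mono) auto
    then have "(2::nat) ^ L \<le> 2 ^ (c * L * (Suc i + 1))"
      by (intro power_increasing) auto
    then have W: "2 ^ L \<le> card W" using Suc.prems(3) by linarith
    \<comment> \<open>For \<open>k = 2 ^ j\<close> these give the bounds
      \<open>k \<le> card W\<close>, \<open>6 \<le> card W\<close> and \<open>3 \<le> k\<close> of
      \<open>sparse_independent\<close>.\<close>
    have exps: "(2::nat) ^ j \<le> 2 ^ L" "(2::nat) ^ 3 \<le> 2 ^ L" "(2::nat) ^ 2 \<le> 2 ^ j"
      using j by (intro power_increasing; simp add: L_def)+
    have k: "3 \<le> (2::nat) ^ j" "2 ^ j \<le> card W" "6 \<le> card W"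
      using exps(3) order_trans[OF exps(1) W] order_trans[OF exps(2) W] by simp_all
    have "2 * card (triples W \<inter> E) * (2 ^ j) ^ 3 = 2 ^ (3 * j + 1) * card (triples W \<inter> E)"
      by (simp add: mult_ac flip: power_mult)
    also have "\<dots> \<le> 2 ^ L * card (triples W \<inter> E)"
      by (intro mult_right_mono power_increasing) (auto simp: L_def)
    also have "\<dots> < card W ^ 3" using False by simp
    finally have "real (2 * card (triples W \<inter> E) * (2 ^ j) ^ 3) < real (card W ^ 3)"
      by (simp only: of_nat_less_iff)
    then obtain S where S: "S \<subseteq> W" "card S = 2 ^ j" "triples S \<inter> E = {}"
      using sparse_independent[OF fin k(1,2,3), of E] by auto
    moreover have "(2::nat) ^ Suc i \<le> 2 ^ j"
      using Suc.prems(1) by (intro power_increasing) auto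
    ultimately show ?thesis by auto
  qed
qed

text \<open>Serves the \<open>N\<close> that are too small for the recursion. At most two triples on
  four points lie in \<open>E\<close>, so among any three of them one is not in
  \<open>E\<close>.\<close>

lemma independent_triple:
  fixes N :: nat
  assumes N: "4 \<le> N" and four: "\<forall>S\<subseteq>{1..N}. card S = 4 \<longrightarrow> card (triples S \<inter> E) \<le> 2"
  shows "\<exists>S\<subseteq>{1..N}. triples S \<inter> E = {} \<and> card S = 3"
proof -
  have "{1, 2, 3, 4} \<subseteq> {1..N}" using N by auto
  then have "card (triples {1, 2, 3, 4} \<inter> E) \<le> 2"
    using four by auto
  moreover have "finite (triples {1, 2, 3, 4} \<inter> E)" by (simp add: finite_triples)
  ultimately have "\<not> {(1, 2, 3), (1, 2, 4), (1, 3, 4)} \<subseteq> triples {1, 2, 3, 4} \<inter> E"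
    using card_ge_3[of "triples {1, 2, 3, 4} \<inter> E" "(1, 2, 3)" "(1, 2, 4)" "(1, 3, 4)"] by auto
  then obtain e where e: "e \<in> {(1, 2, 3), (1, 2, 4), (1, 3, 4)}" "e \<notin> triples {1, 2, 3, 4} \<inter> E"
    by blast
  moreover from e(1) have "e \<in> triples {1, 2, 3, 4}"
    by (auto simp: triples_def)
  ultimately obtain x y z where "(x, y, z) \<in> triples {1, 2, 3, 4}" "(x, y, z) \<notin> E"
    by (cases e) auto
  then have "triples {x, y, z} \<inter> E = {}" "card {x, y, z} = 3" "{x, y, z} \<subseteq> {1, 2, 3, 4}"
    by (auto simp: triples_def)
  then show ?thesis using \<open>{1, 2, 3, 4} \<subseteq> {1..N}\<close> by (intro exI[of _ "{x, y, z}"]) blast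
qed

section \<open>Choice of the exponent and the number of doublings\<close>

theorem theorem6:
  fixes t :: nat
  assumes "t \<ge> 1"
  shows "\<exists>c::real. 0 < c \<and> c < 1 \<and>
    (\<forall>(N::nat) (p :: nat \<Rightarrow> real ^ ('d::finite)) (E :: (nat \<times> nat \<times> nat) set).
       N \<ge> 1 \<longrightarrow> N \<noteq> 3 \<longrightarrow>
       semialgebraic_relation t N p E \<longrightarrow>
       (\<forall>S \<subseteq> {1..N}. card S = 4 \<longrightarrow> card (triples S \<inter> E) \<le> 2) \<longrightarrow>
       (\<exists>P' \<subseteq> {1..N}. triples P' \<inter> E = {} \<and>
          real (card P') \<ge> 2 powr ((log 2 (real N)) powr c)))"
proof -
  obtain c where c: "1 \<le> c" and link: "\<And>N (p :: nat \<Rightarrow> real ^ 'd) E L W.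
    \<lbrakk>semialgebraic_relation t N p E; 1 \<le> L; W \<subseteq> {1..N}; W \<noteq> {};
      card W ^ 3 \<le> 2 ^ L * card (triples W \<inter> E)\<rbrakk> \<Longrightarrow>
    \<exists>v\<in>W. \<exists>A\<subseteq>W. \<exists>B\<subseteq>W. (\<forall>a\<in>A. \<forall>b\<in>B. v < a \<and> a < b \<and> (v, a, b) \<in> E) \<and>
      card W \<le> 2 ^ (c * L) * card A \<and> card W \<le> 2 ^ (c * L) * card B"
    using semialgebraic_dense_link[of t, where 'd = 'd] by metis
  \<comment> \<open>The threshold for \<open>log 2 N\<close> beyond which its square root exceeds
    \<open>32 * c\<close>, the constant lost in the recursion.\<close>
  define l0 where "l0 = (32 * real c) ^ 2"
  have l0: "1 < l0"
    unfolding l0_def using c by (intro one_less_power) auto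
  have log3: "1 < log 2 (3::real)" by simp
  \<comment> \<open>The second term gives \<open>l0 powr \<gamma> \<le> log 2 3\<close>, so three
    points are enough up to the threshold; 1/4 is the exponent that the recursion yields.\<close>
  define \<gamma> where "\<gamma> = min (1 / 4) (ln (log 2 3) / ln l0)"
  have "\<gamma> \<le> 1 / 4" unfolding \<gamma>_def by (rule min.cobounded1)
  moreover have "0 < \<gamma>" using l0 log3 by (simp add: \<gamma>_def)
  ultimately have \<gamma>: "0 < \<gamma>" "\<gamma> < 1" "\<gamma> \<le> 1 / 4" by auto
  have "\<exists>P'\<subseteq>{1..N}. triples P' \<inter> E = {} \<and> 2 powr (log 2 (real N) powr \<gamma>) \<le> real (card P')"
    if N: "1 \<le> N" "N \<noteq> 3" and rel: "semialgebraic_relation t N p E"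
      and four: "\<forall>S\<subseteq>{1..N}. card S = 4 \<longrightarrow> card (triples S \<inter> E) \<le> 2"
    for N and p :: "nat \<Rightarrow> real ^ 'd" and E
  proof -
    define l where "l = log 2 (real N)"
    \<comment> \<open>For \<open>N = 1\<close> and \<open>N = 2\<close> the logarithm is 0 and 1, so
      the bound is 1 and 2 and all points together meet it. At \<open>N = 3\<close> the bound
      exceeds 2 while the only triple may lie in \<open>E\<close>; hence the exclusion.\<close>
    consider "N = 1" | "N = 2" | "4 \<le> N" "l \<le> l0" | "4 \<le> N" "l0 < l"
      using N by linarith
    then show ?thesis
    proof cases
      case 1
      then show ?thesis by (intro exI[of _ "{1..N}"]) (auto simp: triples_def)
    next
      case 2
      then show ?thesis by (intro exI[of _ "{1..N}"]) (auto simp: triples_def)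
    next
      case 3
      then obtain S where S: "S \<subseteq> {1..N}" "triples S \<inter> E = {}" "card S = 3"
        using independent_triple[OF _ four] by blast
      have "0 \<le> l" using N by (simp add: l_def)
      then have "l powr \<gamma> \<le> l0 powr \<gamma>"
        using 3 \<gamma> by (intro powr_mono2) auto
      also have "\<dots> \<le> l0 powr (ln (log 2 3) / ln l0)"
        using l0 by (intro powr_mono) (auto simp: \<gamma>_def)
      also have "\<dots> = log 2 3"
        using l0 log3 by (simp add: powr_def)
      finally have "2 powr (l powr \<gamma>) \<le> 2 powr (log 2 3)" by (intro powr_mono) auto
      also have "\<dots> = 3" by simp
      finally show ?thesis using S by (intro exI[of _ S]) (simp add: l_def)
    next
      case 4
      \<comment> \<open>The recursion needs \<open>c * (3 * j + 2) * (j + 1) \<le> l\<close>, and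
        for \<open>j\<close> at most \<open>2 * s\<close> the left side is at most
        \<open>32 * c * s ^ 2\<close>. With the fourth root, \<open>l = s ^ 4\<close> and the second
        factor \<open>s ^ 2\<close> absorbs \<open>32 * c\<close>.\<close>
      define s where "s = l powr (1 / 4)"
      define j where "j = nat \<lceil>s\<rceil>"
      have l: "1 \<le> l" using 4 l0 by simp
      have s4: "s ^ 4 = l" using l by (simp add: s_def powr_powr flip: powr_realpow)
      have s0: "0 \<le> s" by (simp add: s_def)
      have s2: "32 * real c \<le> s ^ 2"
      proof -
        have "(32 * real c) ^ 2 \<le> (s ^ 2) ^ 2" using 4 s4 by (simp add: l0_def flip: power_mult)
        then show ?thesis by (rule power2_le_imp_le) simp
      qed
      have "2 < s"
      proof (rule ccontr)
        assume "\<not> 2 < s"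
        then have "s ^ 2 \<le> 2 ^ 2" using s0 by (intro power_mono) auto
        then show False using s2 c by simp
      qed
      have j: "s \<le> real j" "real j \<le> 2 * s" "2 \<le> j"
        using \<open>2 < s\<close> by (auto simp: j_def; linarith)+
      have "real (c * (3 * j + 2) * (j + 1)) \<le> real c * (4 * real j) * (2 * real j)"
        using j c by (simp only: of_nat_mult of_nat_add) (intro mult_mono; simp)
      also have "\<dots> = 8 * real c * real j ^ 2" by (simp add: power2_eq_square)
      also have "\<dots> \<le> 8 * real c * (2 * s) ^ 2"
        using j by (intro mult_left_mono power_mono) auto
      also have "\<dots> = 32 * real c * s ^ 2" by simp
      also have "\<dots> \<le> s ^ 2 * s ^ 2" using s2 by (intro mult_right_mono) auto
      also have "\<dots> = l" using s4 by simp
      finally have "2 powr real (c * (3 * j + 2) * (j + 1)) \<le> 2 powr l" by simp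
      also have "2 powr l = real N" using N by (simp add: l_def)
      finally have "real (2 ^ (c * (3 * j + 2) * (j + 1))) \<le> real N"
        by (simp only: powr_realpow of_nat_power of_nat_numeral zero_less_numeral)
      then have big: "2 ^ (c * (3 * j + 2) * (j + 1)) \<le> card {1..N}" by simp
      obtain S where S: "S \<subseteq> {1..N}" "triples S \<inter> E = {}" "2 ^ j \<le> card S"
        using independent_doubling[OF c j(3) four link[OF rel], of j "{1..N}"] big by auto
      have "l powr \<gamma> \<le> s"
        unfolding s_def using l \<gamma> by (intro powr_mono) auto
      then have "2 powr (l powr \<gamma>) \<le> 2 powr real j" using j by simp
      also have "\<dots> = real (2 ^ j)" by (simp add: powr_realpow)
      also have "\<dots> \<le> real (card S)" using S by (simp only: of_nat_le_iff)
      finally show ?thesis using S by (intro exI[of _ S]) (simp add: l_def)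
    qed
  qed
  then show ?thesis using \<gamma> by (intro exI[of _ \<gamma>]) blast
qed

end
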